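(* In each of the following cases: (a) $n$ is odd and $k=n-1$; (b) $n=7$ and $k=4$; (c) $n=15$ and $k=8$; the following bound is tight: "for any continuous map $f:\mathbb{R}P^n \to N$ to a $k$-dimensional manifold $N$ there exists $y\in N$ such that $\mathrm{vol} (\nu_t f^{-1}(y)) \ge \mathrm{vol} (\nu_t \mathbb{R}P^{n-k})$ for all $t>0$". That is, there exist a $k$-dimensional manifold $N$ and a continuous map $f:\mathbb{R}P^n\to N$ such that $\mathrm{vol} (\nu_t f^{-1}(y)) \le \mathrm{vol} (\nu_t \mathbb{R}P^{n-k})$ for all $y\in N$ and all $t>0$.
   Context: $\mathbb{R}P^n=\mathbb{S}^n/\{\pm1\}$ carries the metric coming from the projection $\mathbb{S}^n\to\mathbb{R}P^n$ from the unit round sphere, $\mathrm{vol}$ is the corresponding Riemannian volume, and $\mathbb{R}P^{n-k}\subset\mathbb{R}P^n$ is a standard geodesic $(n-k)$-dimensional projective subspace. For a subset $X$ of a metric space, $\nu_t X$ is the set of points of the space at distance less than $t$ from $X$. *)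

theory Defs
  imports "HOL-Analysis.Analysis"
begin

section \<open>Real projective space\<close>

text \<open>The ambient Euclidean space of dimension \<open>n + 1\<close> is \<open>(real^'n) \<times> real\<close> with \<open>CARD('n) = n\<close>
  (the library's norm on products is the Euclidean one), so that \<open>real^'n\<close> is available as the
  parameter space for the \<open>n\<close>-dimensional unit sphere. A point of projective space is an
  antipodal pair.\<close>

definition rp_proj :: "(real^'n) \<times> real \<Rightarrow> ((real^'n) \<times> real) set"
  where "rp_proj x = {x, - x}"

definition rp :: "((real^'n) \<times> real) set set"
  where "rp = rp_proj ` sphere 0 1"

definition rp_topology :: "((real^'n) \<times> real) set topology"
  where "rp_topology = topology (\<lambda>V. V \<subseteq> rp \<and>
    openin (top_of_set (sphere 0 1)) {x \<in> sphere 0 1. rp_proj x \<in> V})"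

lemma openin_rp_topology:
  "openin rp_topology V \<longleftrightarrow> V \<subseteq> rp \<and>
    openin (top_of_set (sphere 0 1)) {x \<in> sphere 0 1. rp_proj x \<in> V}"
proof -
  have "istopology (\<lambda>V. V \<subseteq> rp \<and>
    openin (top_of_set (sphere 0 1)) {x \<in> sphere 0 1. rp_proj x \<in> V})" (is "istopology ?L")
    unfolding istopology_def
  proof (intro conjI allI impI)
    fix S T assume "?L S" "?L T"
    moreover have "{x \<in> sphere 0 1. rp_proj x \<in> S \<inter> T} =
        {x \<in> sphere 0 1. rp_proj x \<in> S} \<inter> {x \<in> sphere 0 1. rp_proj x \<in> T}" by auto
    ultimately show "S \<inter> T \<subseteq> rp"
      and "openin (top_of_set (sphere 0 1)) {x \<in> sphere 0 1. rp_proj x \<in> S \<inter> T}"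
      by (auto intro: openin_Int)
  next
    fix K assume K: "\<forall>V\<in>K. ?L V"
    then show "\<Union>K \<subseteq> rp" by blast
    have "{x \<in> sphere 0 1. rp_proj x \<in> \<Union>K} = (\<Union>V\<in>K. {x \<in> sphere 0 1. rp_proj x \<in> V})"
      by auto
    then show "openin (top_of_set (sphere 0 1)) {x \<in> sphere 0 1. rp_proj x \<in> \<Union>K}"
      using K by auto
  qed
  then show ?thesis
    unfolding rp_topology_def by (subst topology_inverse') auto
qed

lemma quotient_map_rp_proj:
  "quotient_map (top_of_set (sphere 0 1)) rp_topology rp_proj"
proof -
  have eq: "{x \<in> sphere 0 1. rp_proj x \<in> rp} = sphere 0 1"
    unfolding rp_def by blast
  have "openin rp_topology rp"
    unfolding openin_rp_topology eq by (rule conjI [OF subset_refl openin_subtopology_self])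
  moreover have "topspace rp_topology \<subseteq> rp"
    using openin_topspace [of rp_topology] unfolding openin_rp_topology by (rule conjunct1)
  ultimately have top: "topspace rp_topology = rp"
    by (intro subset_antisym openin_subset)
  show ?thesis
    unfolding quotient_map_def openin_rp_topology top topspace_euclidean_subtopology rp_def
    by blast
qed

text \<open>\<open>arccos (x \<bullet> y)\<close> is the great-circle distance, i.e. the Riemannian distance of the
  unit round sphere.\<close>

definition rp_dist :: "((real^'n) \<times> real) set \<Rightarrow> ((real^'n) \<times> real) set \<Rightarrow> real"
  where "rp_dist p q = Inf {arccos (x \<bullet> y) | x y. x \<in> p \<and> y \<in> q}"

definition rp_nbhd :: "real \<Rightarrow> ((real^'n) \<times> real) set set \<Rightarrow> ((real^'n) \<times> real) set set"
  where "rp_nbhd t X = {q \<in> rp. \<exists>p\<in>X. rp_dist p q < t}"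

definition rp_subspace :: "nat \<Rightarrow> ((real^'n) \<times> real) set set \<Rightarrow> bool"
  where "rp_subspace m P \<longleftrightarrow>
    (\<exists>S. subspace S \<and> dim S = Suc m \<and> P = rp_proj ` (sphere 0 1 \<inter> S))"

section \<open>Riemannian volume\<close>

text \<open>A local parametrization of projective space is given by its lift \<open>\<phi>\<close> to the sphere; as
  the projection is a local isometry, the metric tensor of \<open>rp_proj \<circ> \<phi>\<close> is the Gram matrix of
  the partial derivatives of \<open>\<phi>\<close>.\<close>

definition rp_parametrization :: "(real^'n) set \<Rightarrow> (real^'n \<Rightarrow> (real^'n) \<times> real) \<Rightarrow> bool"
  where "rp_parametrization U \<phi> \<longleftrightarrow>
    open U \<and> \<phi> ` U \<subseteq> sphere 0 1 \<and> inj_on (\<lambda>u. rp_proj (\<phi> u)) U \<and>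
    (\<forall>u\<in>U. \<phi> differentiable (at u) \<and> inj (frechet_derivative \<phi> (at u))) \<and>
    (\<forall>v. continuous_on U (\<lambda>u. frechet_derivative \<phi> (at u) v))"

definition metric_tensor :: "(real^'n \<Rightarrow> (real^'n) \<times> real) \<Rightarrow> real^'n \<Rightarrow> real^'n^'n"
  where "metric_tensor \<phi> u = (\<chi> i j.
    frechet_derivative \<phi> (at u) (axis i 1) \<bullet> frechet_derivative \<phi> (at u) (axis j 1))"

definition patch_volume :: "(real^'n \<Rightarrow> (real^'n) \<times> real) \<Rightarrow> (real^'n) set \<Rightarrow> ennreal"
  where "patch_volume \<phi> B = (\<integral>\<^sup>+u\<in>B. ennreal (sqrt (det (metric_tensor \<phi> u))) \<partial>lborel)"

text \<open>The Riemannian volume as an outer measure, in the same way as Lebesgue measure arises from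
  boxes: the infimum of the total volume of countable covers by parametrized Borel patches. Since
  every set of projective space that is Borel is a disjoint union of countably many such patches,
  the infimum is attained there, and the value is the usual one, obtained by integrating the
  density \<open>sqrt (det g)\<close> in charts. The sets measured below are open. Taking \<open>\<phi> i\<close> with \<open>B i = {}\<close>
  accounts for finite covers.\<close>

definition rp_volume :: "((real^'n) \<times> real) set set \<Rightarrow> ennreal"
  where "rp_volume A = Inf {(\<Sum>i. patch_volume (\<phi> i) (B i)) | \<phi> U B.
    (\<forall>i::nat. rp_parametrization (U i) (\<phi> i) \<and> B i \<in> sets borel \<and> B i \<subseteq> U i) \<and>
    A \<subseteq> (\<Union>i. (\<lambda>u. rp_proj (\<phi> i u)) ` B i)}"

section \<open>Manifolds\<close>

definition topological_manifold :: "nat \<Rightarrow> 'a topology \<Rightarrow> bool"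
  where "topological_manifold k X \<longleftrightarrow>
    Hausdorff_space X \<and> second_countable X \<and>
    (\<forall>x\<in>topspace X. \<exists>U V. openin X U \<and> x \<in> U \<and> openin (Euclidean_space k) V \<and>
      subtopology X U homeomorphic_space subtopology (Euclidean_space k) V)"

end

theory Submission
  imports Defs "HOL-Homology.Homology"
begin

text \<open>In each case the unit sphere over the projective space carries a Hopf fibration whose fibres
  are \<^emph>\<open>great\<close> subspheres: circles for odd \<open>n\<close> (complex multiplication), three-spheres in
  dimension 7 (quaternions) and seven-spheres in dimension 15 (octonions). Such a fibration is
  invariant under the antipodal map, so it descends to \<open>f\<close> on the projective space, and every fibre
  of \<open>f\<close> is a projective subspace of dimension \<open>n - k\<close>. Any two such subspaces are exchanged by an
  orthogonal transformation of the ambient space, which acts by isometries and preserves the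
  volume; hence all fibres have tubes of exactly the volume that the bound allows
  (\<open>rp_volume_nbhd_subspace_le\<close>). What remains is to produce the fibrations over \<open>k\<close>-manifolds, and
  \<open>great_sphere_fibration_bound\<close> reduces this to a continuous map \<open>F\<close> on the sphere into a
  separable metric space that is constant exactly on the great subspheres and has a manifold as its image.

  For the complex case, \<open>F v\<close> records the orthogonal projection onto the complex line of \<open>v\<close>, so
  that the image is the complex projective space realised by projections; affine charts show that
  it is a manifold. Complex multiplication enters as a linear isometry \<open>J\<close> of the ambient space with
  \<open>J (J v) = - v\<close>, which exists because the dimension \<open>n + 1\<close> is even.

  The other two cases come from a bilinear product \<open>m\<close> on a Euclidean space with
  \<open>norm (m a x) = norm a * norm x\<close>. The fibres are the lines
  \<open>y = m a x\<close> together with \<open>x = 0\<close>, and \<open>F (x, y)\<close> consists of \<open>(norm x)\<^sup>2\<close> and of the transpose of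
  \<open>\<lambda>a. m a x\<close> applied to \<open>y\<close>, which is the slope \<open>a\<close> multiplied by \<open>(norm x)\<^sup>2\<close>. The image is a round
  sphere. The two products arise by doubling the complex numbers.\<close>

section \<open>Orthogonal invariance of distance, tubes and volume\<close>

lemma rp_proj_image: "linear Q \<Longrightarrow> Q ` rp_proj x = rp_proj (Q x)"
  by (simp add: rp_proj_def linear_neg [of Q])

lemma rp_dist_orthogonal:
  assumes "orthogonal_transformation Q"
  shows "rp_dist (Q ` p) (Q ` q) = rp_dist p q"
proof -
  have inner: "Q x \<bullet> Q y = x \<bullet> y" for x y
    using assms by (simp only: orthogonal_transformation_def)
  have "{arccos (x \<bullet> y) | x y. x \<in> Q ` p \<and> y \<in> Q ` q} =
      {arccos (Q x \<bullet> Q y) | x y. x \<in> p \<and> y \<in> q}"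
    by blast
  then show ?thesis by (simp only: rp_dist_def inner)
qed

lemma orthogonal_transformation_image_rp:
  assumes "orthogonal_transformation Q" "p \<in> rp"
  shows "Q ` p \<in> rp"
proof -
  obtain x where "norm x = 1" "p = rp_proj x"
    using assms(2) by (auto simp: rp_def)
  then show ?thesis
    by (simp add: rp_def rp_proj_image [OF orthogonal_transformation_linear [OF assms(1)]]
        orthogonal_transformation_norm [OF assms(1)])
qed

lemma rp_nbhd_orthogonal:
  assumes Q: "orthogonal_transformation Q" and XY: "(`) Q ` X \<subseteq> Y"
  shows "(`) Q ` rp_nbhd t X \<subseteq> rp_nbhd t Y"
proof clarify
  fix q assume "q \<in> rp_nbhd t X"
  then obtain p where "q \<in> rp" "p \<in> X" "rp_dist p q < t"
    by (auto simp: rp_nbhd_def)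
  then show "Q ` q \<in> rp_nbhd t Y"
    using XY rp_dist_orthogonal [OF Q, of p q] orthogonal_transformation_image_rp [OF Q]
    unfolding rp_nbhd_def by (smt (verit) image_subset_iff mem_Collect_eq)
qed

lemma frechet_derivative_linear_compose:
  fixes R :: "'b::euclidean_space \<Rightarrow> 'c::real_normed_vector"
  assumes "linear R" "\<phi> differentiable (at u)"
  shows "frechet_derivative (R \<circ> \<phi>) (at u) = R \<circ> frechet_derivative \<phi> (at u)"
    and "(R \<circ> \<phi>) differentiable (at u)"
proof -
  have "(\<phi> has_derivative frechet_derivative \<phi> (at u)) (at u)"
    using assms(2) frechet_derivative_works by blast
  moreover have "(R has_derivative R) (at (\<phi> u))"
    using assms(1) by (simp add: linear_conv_bounded_linear bounded_linear_imp_has_derivative)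
  ultimately have *: "((R \<circ> \<phi>) has_derivative (R \<circ> frechet_derivative \<phi> (at u))) (at u)"
    by (rule diff_chain_at)
  then show "frechet_derivative (R \<circ> \<phi>) (at u) = R \<circ> frechet_derivative \<phi> (at u)"
    by (simp add: frechet_derivative_at [symmetric])
  show "(R \<circ> \<phi>) differentiable (at u)"
    using * by (rule differentiableI)
qed

lemma metric_tensor_orthogonal:
  assumes "orthogonal_transformation R" "\<phi> differentiable (at u)"
  shows "metric_tensor (R \<circ> \<phi>) u = metric_tensor \<phi> u"
proof -
  have "R x \<bullet> R y = x \<bullet> y" for x y
    using assms(1) by (simp only: orthogonal_transformation_def)
  then show ?thesis
    by (simp only: metric_tensor_def o_apply
        frechet_derivative_linear_compose(1) [OF orthogonal_transformation_linear [OF assms(1)] assms(2)])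
qed

lemma rp_parametrization_orthogonal:
  assumes R: "orthogonal_transformation R" and \<phi>: "rp_parametrization U \<phi>"
  shows "rp_parametrization U (R \<circ> \<phi>)"
proof -
  have lin: "linear R" and injR: "inj R"
    using R by (auto simp: orthogonal_transformation_linear orthogonal_transformation_inj)
  have diff: "\<phi> differentiable (at u)" if "u \<in> U" for u
    using \<phi> that by (simp add: rp_parametrization_def)
  have "inj_on (\<lambda>u. rp_proj ((R \<circ> \<phi>) u)) U"
  proof (rule inj_onI)
    fix u v assume "u \<in> U" "v \<in> U" "rp_proj ((R \<circ> \<phi>) u) = rp_proj ((R \<circ> \<phi>) v)"
    then have "R ` rp_proj (\<phi> u) = R ` rp_proj (\<phi> v)"
      by (simp add: rp_proj_image [OF lin])
    then have "rp_proj (\<phi> u) = rp_proj (\<phi> v)"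
      using injR by (simp add: inj_image_eq_iff)
    with \<phi> \<open>u \<in> U\<close> \<open>v \<in> U\<close> show "u = v"
      by (auto simp: rp_parametrization_def inj_on_def)
  qed
  moreover have "(R \<circ> \<phi>) ` U \<subseteq> sphere 0 1"
    using \<phi> by (auto simp: rp_parametrization_def orthogonal_transformation_norm [OF R])
  moreover have "inj (frechet_derivative (R \<circ> \<phi>) (at u))" if "u \<in> U" for u
    using \<phi> that injR
    by (simp add: frechet_derivative_linear_compose(1) [OF lin diff] rp_parametrization_def inj_compose)
  moreover have "continuous_on U (\<lambda>u. frechet_derivative (R \<circ> \<phi>) (at u) v)" for v
  proof -
    have "continuous_on U (\<lambda>u. frechet_derivative \<phi> (at u) v)"
      using \<phi> by (simp add: rp_parametrization_def)
    then have "continuous_on U (\<lambda>u. R (frechet_derivative \<phi> (at u) v))"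
      by (rule linear_continuous_on_compose [OF _ lin])
    then show ?thesis
      by (rule continuous_on_eq) (simp add: frechet_derivative_linear_compose(1) [OF lin diff])
  qed
  ultimately show ?thesis
    using \<phi> frechet_derivative_linear_compose(2) [OF lin diff]
    by (simp add: rp_parametrization_def)
qed

text \<open>The density depends only on the inner products of the derivatives of \<open>\<phi>\<close>, which an orthogonal
  transformation preserves.\<close>

lemma patch_volume_orthogonal:
  assumes R: "orthogonal_transformation R" and \<phi>: "rp_parametrization U \<phi>" and "B \<subseteq> U"
  shows "patch_volume (R \<circ> \<phi>) B = patch_volume \<phi> B"
proof -
  have "\<phi> differentiable (at u)" if "u \<in> B" for u
    using \<phi> \<open>B \<subseteq> U\<close> that by (auto simp: rp_parametrization_def)
  then show ?thesis
    unfolding patch_volume_def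
    by (intro nn_integral_cong)
      (auto simp: metric_tensor_orthogonal [OF R] split: split_indicator)
qed

text \<open>A cover of \<open>C\<close> is pulled back along \<open>Q\<close> to a cover of \<open>A\<close> by patches of equal volume, so
  the infimum for \<open>A\<close> runs over at least as many values.\<close>

lemma rp_volume_orthogonal_le:
  fixes Q :: "(real^'n) \<times> real \<Rightarrow> (real^'n) \<times> real"
  assumes Q: "orthogonal_transformation Q" and AC: "(`) Q ` A \<subseteq> C"
  shows "rp_volume A \<le> rp_volume C"
proof -
  define R where "R = inv_into UNIV Q"
  have R: "orthogonal_transformation R"
    unfolding R_def using Q by (rule orthogonal_transformation_inv)
  have RQ: "R ` Q ` p = p" for p
    using orthogonal_transformation_inj [OF Q] by (simp add: R_def image_image)
  show ?thesis
    unfolding rp_volume_def [of C]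
  proof (rule Inf_greatest, clarify)
    fix \<phi> :: "nat \<Rightarrow> real^'n \<Rightarrow> (real^'n) \<times> real" and U B
    assume cov: "\<forall>i. rp_parametrization (U i) (\<phi> i) \<and> B i \<in> sets borel \<and> B i \<subseteq> U i"
      and C: "C \<subseteq> (\<Union>i. (\<lambda>u. rp_proj (\<phi> i u)) ` B i)"
    have "A \<subseteq> (\<Union>i. (\<lambda>u. rp_proj ((R \<circ> \<phi> i) u)) ` B i)"
    proof
      fix p assume "p \<in> A"
      then have "Q ` p \<in> C" using AC by blast
      then obtain i u where u: "u \<in> B i" "Q ` p = rp_proj (\<phi> i u)"
        using C by auto
      have "p = R ` Q ` p" by (simp only: RQ)
      also have "\<dots> = rp_proj ((R \<circ> \<phi> i) u)"
        by (simp only: u rp_proj_image [OF orthogonal_transformation_linear [OF R]] o_def)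
      finally show "p \<in> (\<Union>i. (\<lambda>u. rp_proj ((R \<circ> \<phi> i) u)) ` B i)"
        using u(1) by blast
    qed
    then have "rp_volume A \<le> suminf (\<lambda>i. patch_volume (R \<circ> \<phi> i) (B i))"
      unfolding rp_volume_def [of A] using cov rp_parametrization_orthogonal [OF R]
      by (intro Inf_lower CollectI exI [of _ "\<lambda>i. R \<circ> \<phi> i"] exI [of _ U] exI [of _ B] conjI allI refl)
        auto
    also have "\<dots> = suminf (\<lambda>i. patch_volume (\<phi> i) (B i))"
      using cov patch_volume_orthogonal [OF R] by metis
    finally show "rp_volume A \<le> suminf (\<lambda>i. patch_volume (\<phi> i) (B i))" .
  qed
qed

text \<open>An isometry between the subspaces and one between their orthogonal complements are glued
  along the orthogonal decomposition.\<close>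

lemma orthogonal_transformation_subspace_exists:
  fixes S T :: "'a::euclidean_space set"
  assumes S: "subspace S" and T: "subspace T" and dim: "dim S = dim T"
  obtains Q where "orthogonal_transformation Q" "Q ` S \<subseteq> T"
proof -
  have dim_comp: "dim (W\<^sup>\<bottom>) + dim W = DIM('a)" if "subspace W" for W :: "'a set"
    using dim_subspace_orthogonal_to_vectors [OF that subspace_UNIV]
    by (simp add: orthogonal_comp_def)
  obtain f where f: "linear f" "f ` S = T" and fn: "\<And>x. x \<in> S \<Longrightarrow> norm (f x) = norm x"
    using isometries_subspaces [OF S T dim] by metis
  have "dim (S\<^sup>\<bottom>) = dim (T\<^sup>\<bottom>)"
    using dim_comp [OF S] dim_comp [OF T] dim by linarith
  then obtain g where g: "linear g" "g ` (S\<^sup>\<bottom>) = T\<^sup>\<bottom>"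
      and gn: "\<And>x. x \<in> S\<^sup>\<bottom> \<Longrightarrow> norm (g x) = norm x"
    using isometries_subspaces [OF subspace_orthogonal_comp subspace_orthogonal_comp] by metis
  obtain B where B: "B \<subseteq> S" "pairwise orthogonal B" "\<And>x. x \<in> B \<Longrightarrow> norm x = 1"
      "independent B" "span B = S"
    using orthonormal_basis_subspace [OF S] by metis
  have "finite B" using B independent_imp_finite by blast
  \<comment> \<open>the orthogonal projection onto \<open>S\<close>\<close>
  define \<pi> where "\<pi> v = (\<Sum>b\<in>B. (v \<bullet> b) *\<^sub>R b)" for v
  have lin: "linear \<pi>"
    unfolding \<pi>_def
    by (intro linear_compose_sum ballI linearI) (auto simp: inner_add_left algebra_simps)
  have \<pi>S: "\<pi> v \<in> S" for v
    unfolding \<pi>_def using B S by (intro subspace_sum subspace_mul) auto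
  have bb: "b \<bullet> c = (if b = c then 1 else 0)" if "b \<in> B" "c \<in> B" for b c
    using B that by (auto simp: pairwise_def orthogonal_def norm_eq_1)
  have "(v - \<pi> v) \<bullet> b = 0" if "b \<in> B" for v b
    using that \<open>finite B\<close> by (simp add: \<pi>_def inner_diff_left inner_sum_left bb sum.delta if_distrib cong: if_cong sum.cong)
  then have \<pi>O: "v - \<pi> v \<in> S\<^sup>\<bottom>" for v
    using B(5) orthogonal_to_span [of _ B "v - \<pi> v"]
    by (auto simp: orthogonal_comp_def orthogonal_def inner_commute)
  define Q where "Q v = f (\<pi> v) + g (v - \<pi> v)" for v
  have "linear Q"
    unfolding Q_def
    using linear_compose [OF lin f(1)] linear_compose [OF linear_compose_sub [OF linear_ident lin] g(1)]
    by (intro linear_compose_add) (simp_all add: o_def)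
  moreover have "norm (Q v) = norm v" for v
  proof -
    have "f (\<pi> v) \<in> T" "g (v - \<pi> v) \<in> T\<^sup>\<bottom>"
      using f g \<pi>S \<pi>O by blast+
    then have "norm (Q v) ^ 2 = norm (f (\<pi> v)) ^ 2 + norm (g (v - \<pi> v)) ^ 2"
      unfolding Q_def by (intro norm_add_Pythagorean) (auto simp: orthogonal_comp_def)
    also have "\<dots> = norm (\<pi> v) ^ 2 + norm (v - \<pi> v) ^ 2"
      by (simp add: fn gn \<pi>S \<pi>O)
    also have "\<dots> = norm (\<pi> v + (v - \<pi> v)) ^ 2"
      using \<pi>S [of v] \<pi>O [of v] by (intro norm_add_Pythagorean [symmetric]) (auto simp: orthogonal_comp_def)
    finally show ?thesis by simp
  qed
  ultimately have "orthogonal_transformation Q"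
    by (simp add: orthogonal_transformation)
  moreover have "Q ` S \<subseteq> T"
  proof clarify
    fix s assume s: "s \<in> S"
    then have "s - \<pi> s \<in> S" using \<pi>S S by (simp add: subspace_diff)
    then have "s - \<pi> s = 0"
      using \<pi>O [of s] by (auto simp: orthogonal_comp_def orthogonal_def)
    then show "Q s \<in> T"
      using f s linear_0 [OF g(1)] by (auto simp: Q_def)
  qed
  ultimately show thesis by (rule that)
qed

lemma rp_volume_nbhd_subspace_le:
  fixes P X :: "((real^'n) \<times> real) set set"
  assumes P: "rp_subspace m P" and X: "rp_subspace m X"
  shows "rp_volume (rp_nbhd t X) \<le> rp_volume (rp_nbhd t P)"
proof -
  obtain S where S: "subspace S" "dim S = Suc m" "X = rp_proj ` (sphere 0 1 \<inter> S)"
    using X by (auto simp: rp_subspace_def)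
  obtain T where T: "subspace T" "dim T = Suc m" "P = rp_proj ` (sphere 0 1 \<inter> T)"
    using P by (auto simp: rp_subspace_def)
  obtain Q where Q: "orthogonal_transformation Q" "Q ` S \<subseteq> T"
    using orthogonal_transformation_subspace_exists [OF S(1) T(1)] S T by metis
  have "(`) Q ` X \<subseteq> P"
    using Q(2) rp_proj_image [OF orthogonal_transformation_linear [OF Q(1)]]
      orthogonal_transformation_norm [OF Q(1)]
    by (force simp: S T)
  then show ?thesis
    by (intro rp_volume_orthogonal_le [OF Q(1)] rp_nbhd_orthogonal [OF Q(1)])
qed


section \<open>Manifolds and great-sphere fibrations\<close>

lemma topological_manifold_homeomorphic_space:
  assumes X: "topological_manifold k X" and "X homeomorphic_space Y"
  shows "topological_manifold k Y"
proof -
  obtain f g where fg: "homeomorphic_maps X Y f g"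
    using \<open>X homeomorphic_space Y\<close> by (auto simp: homeomorphic_space_def)
  have f: "homeomorphic_map X Y f"
    using fg by (rule homeomorphic_maps_imp_map)
  have g: "g y \<in> topspace X" "f (g y) = y" if "y \<in> topspace Y" for y
    using fg that by (auto simp: homeomorphic_maps_def continuous_map_def)
  have "\<exists>U V. openin Y U \<and> y \<in> U \<and> openin (Euclidean_space k) V \<and>
      subtopology Y U homeomorphic_space subtopology (Euclidean_space k) V" if y: "y \<in> topspace Y" for y
  proof -
    obtain U V where U: "openin X U" "g y \<in> U" and V: "openin (Euclidean_space k) V"
        and UV: "subtopology X U homeomorphic_space subtopology (Euclidean_space k) V"
      using X g(1) [OF y] unfolding topological_manifold_def by metis
    have "U \<subseteq> topspace X" using U(1) by (rule openin_subset)
    then have "openin Y (f ` U)" "f ` U \<subseteq> topspace Y"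
      using homeomorphic_map_openness [OF f] U(1) openin_subset by blast+
    moreover have "homeomorphic_map (subtopology X U) (subtopology Y (f ` U)) f"
      using \<open>U \<subseteq> topspace X\<close> \<open>f ` U \<subseteq> topspace Y\<close>
      by (intro homeomorphic_map_subtopologies [OF f]) (simp add: Int_absorb1)
    then have "subtopology Y (f ` U) homeomorphic_space subtopology (Euclidean_space k) V"
      using UV by (meson homeomorphic_map_imp_homeomorphic_space homeomorphic_space_sym homeomorphic_space_trans)
    moreover have "y \<in> f ` U"
      using U(2) g(2) [OF y] by force
    ultimately show ?thesis using V by blast
  qed
  moreover have "Hausdorff_space Y" "second_countable Y"
    using X \<open>X homeomorphic_space Y\<close> homeomorphic_Hausdorff_space homeomorphic_space_second_countability
    unfolding topological_manifold_def by blast+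
  ultimately show ?thesis
    by (simp add: topological_manifold_def)
qed

lemma second_countable_euclidean:
  "second_countable (euclidean :: 'a::second_countable_topology topology)"
proof -
  obtain \<B> :: "'a set set" where "countable \<B>" "\<And>C. C \<in> \<B> \<Longrightarrow> open C"
      and \<B>: "\<And>S. open S \<Longrightarrow> \<exists>U. U \<subseteq> \<B> \<and> S = \<Union>U"
    using univ_second_countable by metis
  moreover have "\<exists>V\<in>\<B>. x \<in> V \<and> V \<subseteq> U" if "open U" "x \<in> U" for U x
    using \<B> [OF \<open>open U\<close>] \<open>x \<in> U\<close> by blast
  ultimately show ?thesis
    unfolding second_countable_def by (intro exI [of _ \<B>]) auto
qed

text \<open>For a subset of a separable metric space only the charts have to be provided. A chart may
  take values in any linear subspace of dimension \<open>k\<close>; a hyperplane or an orthogonal complement is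
  then as good as a coordinate space.\<close>

lemma topological_manifold_top_of_set:
  fixes M :: "'a::{metric_space, second_countable_topology} set"
    and T :: "'a \<Rightarrow> 'b::euclidean_space set"
  assumes "\<And>x. x \<in> M \<Longrightarrow> openin (top_of_set M) (U x) \<and> x \<in> U x \<and> U x homeomorphic T x \<and>
      subspace (T x) \<and> dim (T x) = k"
  shows "topological_manifold k (top_of_set M)"
  unfolding topological_manifold_def
proof (intro conjI ballI)
  show "Hausdorff_space (top_of_set M)"
    by (intro Hausdorff_space_subtopology Hausdorff_space_euclidean)
  show "second_countable (top_of_set M)"
    by (intro second_countable_subtopology second_countable_euclidean)
next
  fix x assume "x \<in> topspace (top_of_set M)"
  then have U: "openin (top_of_set M) (U x)" "x \<in> U x" "U x homeomorphic T x"
      and T: "subspace (T x)" "dim (T x) = k"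
    using assms by auto
  have "subtopology (top_of_set M) (U x) = top_of_set (U x)"
    using openin_imp_subset [OF U(1)] by (simp add: subtopology_subtopology Int_absorb1)
  moreover have "top_of_set (U x) homeomorphic_space top_of_set (T x)"
    using U(3) by simp
  moreover have "top_of_set (T x) homeomorphic_space Euclidean_space k"
    using T homeomorphic_subspace_Euclidean_space by blast
  ultimately have "subtopology (top_of_set M) (U x) homeomorphic_space
      subtopology (Euclidean_space k) (topspace (Euclidean_space k))"
    by (metis homeomorphic_space_trans subtopology_topspace)
  then show "\<exists>U V. openin (top_of_set M) U \<and> x \<in> U \<and> openin (Euclidean_space k) V \<and>
      subtopology (top_of_set M) U homeomorphic_space subtopology (Euclidean_space k) V"
    using U by blast
qed

text \<open>Around \<open>x\<close> the chart is stereographic projection from the point opposite to \<open>x\<close>, which is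
  \<open>2 *\<^sub>R c - x\<close>.\<close>

lemma topological_manifold_sphere:
  fixes c :: "'a::euclidean_space"
  assumes "0 < r" "DIM('a) = Suc k"
  shows "topological_manifold k (top_of_set (sphere c r))"
proof -
  obtain e :: 'a where e: "e \<in> Basis" using nonempty_Basis by blast
  have e0: "e \<noteq> 0" using e by (rule nonzero_Basis)
  show ?thesis
  proof (rule topological_manifold_top_of_set
      [where U = "\<lambda>x. sphere c r - {2 *\<^sub>R c - x}" and T = "\<lambda>_. {y. e \<bullet> y = 0}"], intro conjI)
    fix x assume x: "x \<in> sphere c r"
    have anti: "2 *\<^sub>R c - x \<in> sphere c r"
      using x by (simp add: dist_norm norm_minus_commute scaleR_2 algebra_simps)
    show "openin (top_of_set (sphere c r)) (sphere c r - {2 *\<^sub>R c - x})"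
      by (simp add: openin_delete)
    have "x \<noteq> 2 *\<^sub>R c - x"
    proof
      assume "x = 2 *\<^sub>R c - x"
      then have "2 *\<^sub>R x = 2 *\<^sub>R c" by (simp add: scaleR_2 algebra_simps)
      then show False using x \<open>0 < r\<close> by simp
    qed
    then show "x \<in> sphere c r - {2 *\<^sub>R c - x}" using x by simp
    show "sphere c r - {2 *\<^sub>R c - x} homeomorphic {y. e \<bullet> y = 0}"
      using homeomorphic_punctured_sphere_hyperplane [OF \<open>0 < r\<close> anti e0] .
    show "subspace {y. e \<bullet> y = 0}" by (rule subspace_hyperplane)
    show "dim {y. e \<bullet> y = 0} = k" using dim_hyperplane [OF e0] assms by simp
  qed
qed

text \<open>The manifold has to consist of sets of points of the ambient space, whereas \<open>F\<close> takes its
  values in an arbitrary separable metric space. The fibre of \<open>F\<close> over a value is such a set and determines the value, so the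
  image of \<open>F\<close> is transported to the set of fibres.\<close>

lemma great_sphere_fibration_bound:
  fixes F :: "(real^'n) \<times> real \<Rightarrow> 's::{metric_space, second_countable_topology}"
  assumes cont: "continuous_on (sphere 0 1) F"
    and man: "topological_manifold k (top_of_set (F ` sphere 0 1))"
    and fib: "\<And>v. norm v = 1 \<Longrightarrow>
      \<exists>S. subspace S \<and> dim S = Suc m \<and> {u \<in> sphere 0 1. F u = F v} = sphere 0 1 \<inter> S"
  shows "\<exists>(N :: ((real^'n) \<times> real) set topology) (f :: ((real^'n) \<times> real) set \<Rightarrow> ((real^'n) \<times> real) set).
    topological_manifold k N \<and> continuous_map rp_topology N f \<and>
    (\<forall>P :: ((real^'n) \<times> real) set set. rp_subspace m P \<longrightarrow>
      (\<forall>y \<in> topspace N. \<forall>t > 0.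
        rp_volume (rp_nbhd t {p \<in> rp. f p = y}) \<le> rp_volume (rp_nbhd t P)))"
proof -
  define M where "M = F ` sphere 0 1"
  define fibre where "fibre y = {u \<in> sphere 0 1. F u = y}" for y
  define N where "N = pullback_topology (fibre ` M) (inv_into M fibre) (top_of_set M)"
  have inj: "inj_on fibre M"
  proof (rule inj_onI)
    fix y z assume "y \<in> M" "z \<in> M" "fibre y = fibre z"
    then obtain v where "v \<in> fibre y" by (auto simp: M_def fibre_def)
    then show "y = z" using \<open>fibre y = fibre z\<close> by (auto simp: fibre_def)
  qed
  have topN: "topspace N = fibre ` M"
    using inj by (auto simp: N_def topspace_pullback_topology inv_into_into)
  have fN: "continuous_map (top_of_set M) N fibre"
    unfolding N_def
  proof (rule continuous_map_pullback')
    show "continuous_map (top_of_set M) (top_of_set M) (inv_into M fibre \<circ> fibre)"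
      by (rule continuous_map_eq [OF continuous_map_id]) (simp add: inj)
    show "topspace (top_of_set M) \<subseteq> fibre -` fibre ` M" by auto
  qed
  moreover have "continuous_map N (top_of_set M) (inv_into M fibre)"
    unfolding N_def using continuous_map_pullback [OF continuous_map_id] by auto
  ultimately have "homeomorphic_maps (top_of_set M) N fibre (inv_into M fibre)"
    using inj by (simp add: homeomorphic_maps_def topN f_inv_into_f)
  then have manN: "topological_manifold k N"
    using man topological_manifold_homeomorphic_space homeomorphic_maps_imp_homeomorphic_space
    unfolding M_def by blast
  \<comment> \<open>a great subsphere contains the antipodes of its points\<close>
  have even: "F (- v) = F v" if "v \<in> sphere 0 1" for v
  proof -
    have "norm v = 1" using that by simp
    from fib [OF this] obtain S where S: "subspace S" "{u \<in> sphere 0 1. F u = F v} = sphere 0 1 \<inter> S"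
      by blast
    have "v \<in> S" using S(2) that by blast
    then have "- v \<in> sphere 0 1 \<inter> S" using S(1) that by (simp add: subspace_neg)
    then show ?thesis using S(2) by blast
  qed
  \<comment> \<open>by \<open>even\<close>, the choice of the representative does not matter\<close>
  define f where "f p = fibre (F (SOME v. v \<in> p))" for p
  have f: "f (rp_proj v) = fibre (F v)" if "v \<in> sphere 0 1" for v
  proof -
    have "(SOME u. u \<in> rp_proj v) \<in> rp_proj v"
      by (rule someI [of _ v]) (simp add: rp_proj_def)
    then show ?thesis
      using even [OF that] by (auto simp: f_def rp_proj_def)
  qed
  have "continuous_map (top_of_set (sphere 0 1)) N (f \<circ> rp_proj)"
  proof (rule continuous_map_eq)
    have "continuous_map (top_of_set (sphere 0 1)) (top_of_set M) F"
      using cont by (auto simp: M_def continuous_map_in_subtopology)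
    then show "continuous_map (top_of_set (sphere 0 1)) N (fibre \<circ> F)"
      using fN by (rule continuous_map_compose)
  qed (simp add: f)
  then have contf: "continuous_map rp_topology N f"
    by (rule continuous_compose_quotient_map [OF quotient_map_rp_proj])
  have "rp_subspace m {p \<in> rp. f p = y}" if y: "y \<in> topspace N" for y
  proof -
    obtain v where v: "v \<in> sphere 0 1" "y = fibre (F v)"
      using y unfolding topN M_def by blast
    have "norm v = 1" using v(1) by simp
    then obtain S where S: "subspace S" "dim S = Suc m" "{u \<in> sphere 0 1. F u = F v} = sphere 0 1 \<inter> S"
      using fib [of v] by blast
    have "f (rp_proj u) = y \<longleftrightarrow> F u = F v" if "u \<in> sphere 0 1" for u
      unfolding f [OF that] v(2) by (rule inj_on_eq_iff [OF inj]) (use that v(1) in \<open>auto simp: M_def\<close>)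
    then have "{p \<in> rp. f p = y} = rp_proj ` {u \<in> sphere 0 1. F u = F v}"
      unfolding rp_def by blast
    then show ?thesis
      using S by (auto simp: rp_subspace_def)
  qed
  then show ?thesis
    using manN contf rp_volume_nbhd_subspace_le by blast
qed

section \<open>The complex Hopf fibration\<close>

text \<open>An orthonormal basis is split into consecutive pairs, and \<open>J\<close> rotates each pair by a right
  angle.\<close>

lemma complex_structure_exists:
  assumes "even DIM('v::euclidean_space)"
  obtains J :: "'v::euclidean_space \<Rightarrow> 'v" where "linear J" "\<And>v. J (J v) = - v" "\<And>u v. J u \<bullet> J v = u \<bullet> v"
proof -
  obtain h where h: "bij_betw h {..<DIM('v)} (Basis :: 'v set)"
    using ex_bij_betw_nat_finite [OF finite_Basis] unfolding atLeast0LessThan by blast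
  \<comment> \<open>\<open>\<tau>\<close> swaps \<open>2 * i\<close> and \<open>2 * i + 1\<close>; with the signs \<open>s\<close>, \<open>J\<close> sends \<open>h i\<close> to \<open>s i *\<^sub>R h (\<tau> i)\<close>\<close>
  define \<tau> where "\<tau> i = (if even i then i + 1 else i - 1)" for i :: nat
  define s :: "nat \<Rightarrow> real" where "s i = (if even i then 1 else -1)" for i
  have \<tau>: "\<tau> i < DIM('v)" "\<tau> (\<tau> i) = i" "s (\<tau> i) = - s i" "s i * s i = 1" if "i < DIM('v)" for i
    using that assms by (cases "even i"; auto simp: \<tau>_def s_def; presburger)+
  have hb: "h i \<in> Basis" if "i < DIM('v)" for i
    using h that by (auto simp: bij_betw_def)
  have hh: "h i \<bullet> h j = (if i = j then 1 else 0)" if "i < DIM('v)" "j < DIM('v)" for i j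
    using h that by (auto simp: inner_Basis hb bij_betw_def inj_on_eq_iff)
  have \<tau>bij: "bij_betw \<tau> {..<DIM('v)} {..<DIM('v)}"
    by (rule bij_betw_byWitness [where f' = \<tau>]) (auto simp: \<tau>)
  define J :: "'v \<Rightarrow> 'v" where "J v = (\<Sum>i<DIM('v). (s i * (v \<bullet> h i)) *\<^sub>R h (\<tau> i))" for v
  have Jh: "J v \<bullet> h (\<tau> j) = s j * (v \<bullet> h j)" if j: "j < DIM('v)" for v j
  proof -
    have "J v \<bullet> h (\<tau> j) = (\<Sum>i<DIM('v). if i = j then s i * (v \<bullet> h i) else 0)"
      unfolding J_def inner_sum_left
    proof (rule sum.cong)
      fix i assume "i \<in> {..<DIM('v)}"
      then have i: "i < DIM('v)" by simp
      have "\<tau> i = \<tau> j \<longleftrightarrow> i = j" using \<tau>(2) [OF i] \<tau>(2) [OF j] by metis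
      then show "((s i * (v \<bullet> h i)) *\<^sub>R h (\<tau> i)) \<bullet> h (\<tau> j) = (if i = j then s i * (v \<bullet> h i) else 0)"
        using hh [OF \<tau>(1) [OF i] \<tau>(1) [OF j]] by simp
    qed simp
    also have "\<dots> = s j * (v \<bullet> h j)" using j by simp
    finally show ?thesis .
  qed
  have sum_Basis: "(\<Sum>b\<in>Basis. f b) = (\<Sum>i<DIM('v). f (h (\<tau> i)))" for f :: "'v \<Rightarrow> real"
    using sum.reindex_bij_betw [OF bij_betw_trans [OF \<tau>bij h], of f] by simp
  have lin: "linear J"
    unfolding J_def by (intro linear_compose_sum ballI linearI) (auto simp: inner_add_left algebra_simps)
  have JJ: "J (J v) = - v" for v
  proof -
    have "J (J v) \<bullet> h j = - v \<bullet> h j" if j: "j < DIM('v)" for j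
      using Jh [OF \<tau>(1) [OF j], of "J v"] Jh [OF j, of v] \<tau> [OF j] by (simp add: algebra_simps flip: mult.assoc)
    then have "J (J v) \<bullet> b = - v \<bullet> b" if "b \<in> Basis" for b
    proof -
      have "b \<in> h ` {..<DIM('v)}" using h that by (simp add: bij_betw_def)
      then show ?thesis using \<open>\<And>j. j < DIM('v) \<Longrightarrow> J (J v) \<bullet> h j = - v \<bullet> h j\<close> by blast
    qed
    then show ?thesis by (rule euclidean_eqI)
  qed
  have "J u \<bullet> J v = u \<bullet> v" for u v
  proof -
    have "J u \<bullet> J v = (\<Sum>i<DIM('v). (J u \<bullet> h (\<tau> i)) * (J v \<bullet> h (\<tau> i)))"
      unfolding euclidean_inner [of "J u" "J v"] by (rule sum_Basis)
    also have "\<dots> = (\<Sum>i<DIM('v). (u \<bullet> h i) * (v \<bullet> h i))"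
    proof (rule sum.cong)
      fix i assume "i \<in> {..<DIM('v)}"
      then have i: "i < DIM('v)" by simp
      have "(J u \<bullet> h (\<tau> i)) * (J v \<bullet> h (\<tau> i)) = (s i * s i) * ((u \<bullet> h i) * (v \<bullet> h i))"
        by (simp only: Jh [OF i] mult_ac)
      then show "(J u \<bullet> h (\<tau> i)) * (J v \<bullet> h (\<tau> i)) = (u \<bullet> h i) * (v \<bullet> h i)"
        using \<tau>(4) [OF i] by simp
    qed simp
    also have "\<dots> = u \<bullet> v"
      using sum.reindex_bij_betw [OF h, of "\<lambda>b. (u \<bullet> b) * (v \<bullet> b)"] by (simp only: euclidean_inner [of u v])
    finally show ?thesis .
  qed
  then show thesis using that lin JJ by blast
qed

text \<open>With \<open>J\<close> as multiplication by the imaginary unit, the complex line of a unit vector \<open>v\<close> is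
  \<open>span {v, J v}\<close>, and \<open>p v\<close> is the orthogonal projection onto it. Two unit vectors span the same
  complex line iff their projections agree, and a projection is determined by its values on a
  basis; the sequence \<open>F v\<close> of these values lies in a separable metric space.

  A line whose projection does not annihilate the basis vector \<open>e\<close>
  meets the affine space of all \<open>e + w\<close> with \<open>w\<close> orthogonal to \<open>e\<close> and \<open>J e\<close> in exactly one point.
  This point is the projection of \<open>e\<close> to the line, divided by its squared norm, and \<open>w\<close> is the affine
  coordinate of the line.\<close>

lemma complex_projective_map_exists:
  assumes "even DIM('v::euclidean_space)" and dim: "DIM('v) = Suc (Suc k)"
  obtains F :: "'v::euclidean_space \<Rightarrow> nat \<Rightarrow> 'v" where "continuous_on (sphere 0 1) F"
    "topological_manifold k (top_of_set (F ` sphere 0 1))"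
    "\<And>v. norm v = 1 \<Longrightarrow> \<exists>S. subspace S \<and> dim S = 2 \<and>
      {u \<in> sphere 0 1. F u = F v} = sphere 0 1 \<inter> S"
proof -
  obtain J :: "'v \<Rightarrow> 'v" where lin: "linear J" and JJ: "\<And>v. J (J v) = - v"
      and J_inner: "\<And>u v. J u \<bullet> J v = u \<bullet> v"
    using complex_structure_exists [OF assms(1)] by metis
  have J_skew: "u \<bullet> J v = - (J u \<bullet> v)" for u v
    using J_inner [of u "J v"] by (simp add: JJ)
  have J_orth: "J v \<bullet> v = 0" for v
    using J_skew [of v v] by (simp add: inner_commute)
  define p where "p v u = (v \<bullet> u) *\<^sub>R v + (J v \<bullet> u) *\<^sub>R J v" for v u
  \<comment> \<open>\<open>p\<close> is unchanged when \<open>v\<close> is multiplied by a complex number of modulus one\<close>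
  have p_comb: "p (a *\<^sub>R v + b *\<^sub>R J v) u = p v u" if "a\<^sup>2 + b\<^sup>2 = 1" for a b v u
  proof -
    define x y where "x = v \<bullet> u" and "y = J v \<bullet> u"
    have "p (a *\<^sub>R v + b *\<^sub>R J v) u =
        (a * x + b * y) *\<^sub>R (a *\<^sub>R v + b *\<^sub>R J v) + (a * y - b * x) *\<^sub>R (a *\<^sub>R J v - b *\<^sub>R v)"
      by (simp add: p_def x_def y_def linear_add [OF lin] linear_scale [OF lin] JJ inner_add_left inner_diff_left)
    also have "\<dots> = ((a\<^sup>2 + b\<^sup>2) * x) *\<^sub>R v + ((a\<^sup>2 + b\<^sup>2) * y) *\<^sub>R J v"
      by (simp add: algebra_simps power2_eq_square)
    finally show ?thesis using that by (simp add: p_def x_def y_def)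
  qed
  have p_self: "p v v = v" if "norm v = 1" for v
    using that by (simp add: p_def J_orth norm_eq_1)
  define F where "F v i = p v (from_nat_into Basis i)" for v and i :: nat
  have cont: "continuous_on A F" for A
  proof (rule continuous_on_coordinatewise_then_product)
    show "continuous_on A (\<lambda>v. F v i)" for i
      unfolding F_def p_def by (intro continuous_intros linear_continuous_on_compose [OF _ lin])
  qed
  have F_eq: "p u w = p v w" if "F u = F v" for u v w
  proof -
    have "p u b = p v b" if "b \<in> Basis" for b
      using \<open>F u = F v\<close> from_nat_into_surj [of Basis b] that
      by (auto simp: F_def fun_eq_iff countable_finite)
    moreover have "linear (p x)" for x
      unfolding p_def by (intro linear_compose_add linearI) (auto simp: inner_add_right algebra_simps)
    ultimately show ?thesis
      by (metis linear_eq_stdbasis)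
  qed
  have dim_line: "dim (span {v, J v}) = 2" if v: "norm v = 1" for v
  proof -
    have vv: "v \<bullet> v = 1" using v by (simp add: norm_eq_1)
    have Jvv: "J v \<bullet> J v = 1" using vv by (simp add: J_inner)
    have "v \<noteq> J v" using J_orth [of v] vv by auto
    moreover have "v \<noteq> 0" "J v \<noteq> 0" using vv Jvv by auto
    then have "independent {v, J v}"
      using J_orth [of v]
      by (intro pairwise_orthogonal_independent) (auto simp: pairwise_insert orthogonal_def inner_commute)
    ultimately show ?thesis
      by (simp add: dim_eq_card_independent)
  qed
  have fib: "\<exists>S. subspace S \<and> dim S = 2 \<and> {u \<in> sphere 0 1. F u = F v} = sphere 0 1 \<inter> S"
    if v: "norm v = 1" for v
  proof (intro exI conjI)
    let ?S = "span {v, J v}"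
    have vv: "v \<bullet> v = 1" using v by (simp add: norm_eq_1)
    have Jvv: "J v \<bullet> J v = 1" using vv by (simp add: J_inner)
    show "dim ?S = 2" using v by (rule dim_line)
    show "{u \<in> sphere 0 1. F u = F v} = sphere 0 1 \<inter> ?S"
    proof (intro equalityI subsetI)
      fix u assume "u \<in> {u \<in> sphere 0 1. F u = F v}"
      then have u: "norm u = 1" "F u = F v" by auto
      then have "u = p v u" using F_eq p_self by metis
      also have "p v u \<in> ?S"
        unfolding p_def by (intro span_add span_scale span_base) auto
      finally show "u \<in> sphere 0 1 \<inter> ?S" using u by simp
    next
      fix u assume u: "u \<in> sphere 0 1 \<inter> ?S"
      then obtain a b where ab: "u = a *\<^sub>R v + b *\<^sub>R J v"
        by (auto simp: span_insert span_singleton algebra_simps)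
      have "u \<bullet> u = a\<^sup>2 + b\<^sup>2"
        by (simp add: ab inner_add_left inner_add_right vv Jvv J_orth [of v]
            inner_commute [of v "J v"] power2_eq_square)
      then have "a\<^sup>2 + b\<^sup>2 = 1" using u by (simp add: norm_eq_1)
      then have "F u = F v" by (simp add: fun_eq_iff F_def ab p_comb)
      then show "u \<in> {u \<in> sphere 0 1. F u = F v}" using u by simp
    qed
  qed simp
  define M where "M = F ` sphere 0 1"
  define idx where "idx y = (SOME i. y i \<noteq> 0)" for y :: "nat \<Rightarrow> 'v"
  define e where "e y = (from_nat_into Basis (idx y) :: 'v)" for y
  define T where "T y = {w. e y \<bullet> w = 0 \<and> J (e y) \<bullet> w = 0}" for y
  have e: "norm (e y) = 1" for y
    by (simp add: e_def from_nat_into)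
  \<comment> \<open>\<open>\<phi>\<close> is the affine coordinate, and \<open>\<psi>\<close> sends \<open>w\<close> to the line of \<open>e y + w\<close>\<close>
  have chart: "{z \<in> M. z (idx y) \<noteq> 0} homeomorphic T y" for y
  proof -
    define \<phi> where "\<phi> z = z (idx y) /\<^sub>R (norm (z (idx y)))\<^sup>2 - e y" for z :: "nat \<Rightarrow> 'v"
    define \<psi> where "\<psi> w = F ((e y + w) /\<^sub>R norm (e y + w))" for w
    have ew: "norm (e y + w) \<noteq> 0" if "w \<in> T y" for w
    proof
      assume "norm (e y + w) = 0"
      then have "e y \<bullet> (e y + w) = 0" by simp
      then show False using that e [of y] by (simp add: T_def inner_add_right norm_eq_1)
    qed
    have F_e: "F v (idx y) = p v (e y)" for v by (simp add: F_def e_def)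
    have \<phi>\<psi>: "\<phi> (\<psi> w) = w \<and> \<psi> w (idx y) \<noteq> 0" if w: "w \<in> T y" for w
    proof -
      define s where "s = norm (e y + w)"
      have s: "s \<noteq> 0" "s > 0" using ew [OF w] by (auto simp: s_def)
      define v where "v = (e y + w) /\<^sub>R s"
      have w0: "w \<bullet> e y = 0" "w \<bullet> J (e y) = 0"
        using w by (simp_all add: T_def inner_commute)
      have ee: "e y \<bullet> e y = 1" "e y \<bullet> J (e y) = 0"
        using e [of y] J_orth [of "e y"] by (simp_all add: norm_eq_1 inner_commute)
      have "v \<bullet> e y = 1 / s"
        by (simp add: v_def inner_add_left w0 ee divide_inverse)
      moreover have "J v \<bullet> e y = 0"
        using J_skew [of v "e y"] by (simp add: v_def inner_add_left w0 ee)
      ultimately have pv: "p v (e y) = v /\<^sub>R s"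
        by (simp add: p_def divide_inverse)
      have "norm v = 1" using s by (simp add: v_def s_def)
      have "\<psi> w (idx y) = v /\<^sub>R s"
        by (simp add: \<psi>_def F_e pv flip: s_def v_def)
      moreover have "norm (v /\<^sub>R s) = 1 / s"
        using s \<open>norm v = 1\<close> by (simp add: divide_inverse)
      moreover have "(v /\<^sub>R s) /\<^sub>R (1 / s)\<^sup>2 = e y + w"
      proof -
        have "s * s * (inverse s * inverse s) = 1" using s by (simp add: field_simps)
        then show ?thesis by (simp add: v_def power2_eq_square)
      qed
      ultimately show ?thesis using s \<open>norm v = 1\<close> by (auto simp: \<phi>_def)
    qed
    have \<psi>\<phi>: "\<psi> (\<phi> z) = z \<and> \<phi> z \<in> T y" if z: "z \<in> M" "z (idx y) \<noteq> 0" for z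
    proof -
      obtain v where v: "norm v = 1" "z = F v" using z by (auto simp: M_def)
      have vv: "v \<bullet> v = 1" "J v \<bullet> J v = 1" using v by (simp_all add: norm_eq_1 J_inner)
      \<comment> \<open>\<open>q\<close> is the projection of \<open>e y\<close>; projecting it back gives \<open>(norm q)\<^sup>2 *\<^sub>R e y\<close>\<close>
      define a b where "a = v \<bullet> e y" and "b = J v \<bullet> e y"
      define q where "q = a *\<^sub>R v + b *\<^sub>R J v"
      have zq: "z (idx y) = q" by (simp add: v F_e p_def a_def b_def q_def)
      have qq: "q \<bullet> q = a\<^sup>2 + b\<^sup>2"
        by (simp add: q_def inner_add_left inner_add_right vv J_orth [of v]
            inner_commute [of v "J v"] power2_eq_square)
      have qn: "(norm q)\<^sup>2 = a\<^sup>2 + b\<^sup>2" by (simp add: power2_norm_eq_inner qq)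
      have q0: "norm q > 0" using z zq by simp
      have qe: "q \<bullet> e y = (norm q)\<^sup>2"
        unfolding qn by (simp add: q_def inner_add_left power2_eq_square flip: a_def b_def)
      have qJe: "q \<bullet> J (e y) = 0"
        using J_skew [of v "e y"] J_inner [of v "e y"]
        by (simp add: q_def inner_add_left flip: a_def b_def)
      have "\<phi> z = q /\<^sub>R (norm q)\<^sup>2 - e y" by (simp add: \<phi>_def zq)
      then have "\<phi> z \<in> T y" and eq: "e y + \<phi> z = q /\<^sub>R (norm q)\<^sup>2"
        using qe qJe q0 e [of y] J_orth [of "e y"]
        by (auto simp: T_def inner_diff_right inner_commute norm_eq_1)
      have "(e y + \<phi> z) /\<^sub>R norm (e y + \<phi> z) = q /\<^sub>R norm q"
        using q0 by (simp add: eq power2_eq_square) (simp add: field_simps)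
      also have "\<dots> = (a / norm q) *\<^sub>R v + (b / norm q) *\<^sub>R J v"
        by (simp add: q_def scaleR_add_right divide_inverse_commute)
      finally have "\<psi> (\<phi> z) = F ((a / norm q) *\<^sub>R v + (b / norm q) *\<^sub>R J v)"
        by (simp add: \<psi>_def)
      moreover have "(a / norm q)\<^sup>2 + (b / norm q)\<^sup>2 = 1"
        using q0 by (simp add: power_divide flip: add_divide_distrib qn)
      ultimately have "\<psi> (\<phi> z) = z"
        by (simp add: fun_eq_iff v F_def p_comb)
      then show ?thesis using \<open>\<phi> z \<in> T y\<close> by simp
    qed
    have "homeomorphism {z \<in> M. z (idx y) \<noteq> 0} (T y) \<phi> \<psi>"
    proof (rule homeomorphismI)
      have "continuous_on A (\<lambda>z. z (idx y))" for A :: "(nat \<Rightarrow> 'v) set"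
        by (rule continuous_on_product_then_coordinatewise [OF continuous_on_id])
      then show "continuous_on {z \<in> M. z (idx y) \<noteq> 0} \<phi>"
        unfolding \<phi>_def by (intro continuous_intros) auto
      show "continuous_on (T y) \<psi>"
        unfolding \<psi>_def
        by (rule continuous_on_compose2 [OF cont [of UNIV]]) (use ew in \<open>auto intro!: continuous_intros\<close>)
      show "\<phi> ` {z \<in> M. z (idx y) \<noteq> 0} \<subseteq> T y" using \<psi>\<phi> by blast
      have "\<psi> w \<in> M" if "w \<in> T y" for w
        using ew [OF that] by (auto simp: \<psi>_def M_def intro!: imageI)
      then show "\<psi> ` T y \<subseteq> {z \<in> M. z (idx y) \<noteq> 0}" using \<phi>\<psi> by blast
    qed (use \<phi>\<psi> \<psi>\<phi> in auto)
    then show ?thesis by (auto simp: homeomorphic_def)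
  qed
  have man: "topological_manifold k (top_of_set M)"
  proof (rule topological_manifold_top_of_set
      [where U = "\<lambda>y. {z \<in> M. z (idx y) \<noteq> 0}" and T = T], intro conjI)
    fix y assume y: "y \<in> M"
    then obtain v where v: "norm v = 1" "y = F v" by (auto simp: M_def)
    \<comment> \<open>a projection onto a line is nonzero, hence nonzero on some basis vector\<close>
    have "\<exists>i. y i \<noteq> 0"
    proof (rule ccontr)
      assume "\<nexists>i. y i \<noteq> 0"
      then have "F v = F 0" using v linear_0 [OF lin] by (auto simp: F_def p_def fun_eq_iff)
      then show False using F_eq [of v 0 v] p_self [OF v(1)] v(1) linear_0 [OF lin] by (auto simp: p_def)
    qed
    then have "y (idx y) \<noteq> 0" unfolding idx_def by (rule someI_ex)
    then show "y \<in> {z \<in> M. z (idx y) \<noteq> 0}" using y by simp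
    have "continuous_on M (\<lambda>z. z (idx y))"
      by (rule continuous_on_product_then_coordinatewise [OF continuous_on_id])
    then have "openin (top_of_set M) (M \<inter> (\<lambda>z. z (idx y)) -` (- {0}))"
      by (rule continuous_openin_preimage_gen) auto
    moreover have "M \<inter> (\<lambda>z. z (idx y)) -` (- {0}) = {z \<in> M. z (idx y) \<noteq> 0}" by auto
    ultimately show "openin (top_of_set M) {z \<in> M. z (idx y) \<noteq> 0}" by simp
    show "{z \<in> M. z (idx y) \<noteq> 0} homeomorphic T y" by (rule chart)
    show "subspace (T y)"
      by (auto simp: T_def subspace_def inner_add_right)
    have T: "T y = {w \<in> UNIV. \<forall>x \<in> span {e y, J (e y)}. orthogonal x w}"
    proof (intro equalityI subsetI)
      fix w assume w: "w \<in> T y"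
      have "orthogonal w x" if "x \<in> span {e y, J (e y)}" for x
        using that by (rule orthogonal_to_span) (use w in \<open>auto simp: T_def orthogonal_def inner_commute\<close>)
      then show "w \<in> {w \<in> UNIV. \<forall>x \<in> span {e y, J (e y)}. orthogonal x w}"
        by (simp add: orthogonal_commute)
    qed (auto simp: T_def orthogonal_def span_base)
    have "dim (span {e y, J (e y)}) = 2" using e by (rule dim_line)
    moreover have "dim (T y) + dim (span {e y, J (e y)}) = dim (UNIV :: 'v set)"
      unfolding T by (intro dim_subspace_orthogonal_to_vectors) auto
    ultimately show "dim (T y) = k" using dim by simp
  qed
  show thesis
  proof (rule that)
    show "continuous_on (sphere 0 1) F" by (rule cont)
    show "topological_manifold k (top_of_set (F ` sphere 0 1))"
      using man unfolding M_def .
  qed (rule fib)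
qed

section \<open>Hopf fibrations from normed products\<close>

text \<open>For \<open>x \<noteq> 0\<close> the map \<open>\<lambda>a. m a x\<close> is \<open>norm x\<close> times an isometry of the space to itself. Hence it is
  bijective, and its transpose \<open>z x\<close> is its inverse up to the factor \<open>(norm x)\<^sup>2\<close>. So each \<open>(x, y)\<close>
  with \<open>x \<noteq> 0\<close> lies on exactly one graph \<open>y = m a x\<close>, with \<open>z x y = (norm x)\<^sup>2 *\<^sub>R a\<close>. On the unit
  sphere, \<open>s = (norm x)\<^sup>2\<close> and \<open>w = z x y\<close> satisfy \<open>(norm w)\<^sup>2 = s * (1 - s)\<close>, the equation of the
  sphere of radius \<open>1/2\<close> around \<open>(1/2, 0)\<close>; its point \<open>(0, 0)\<close> is the line \<open>x = 0\<close>.\<close>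

lemma normed_product_hopf_map:
  fixes m :: "'a::euclidean_space \<Rightarrow> 'a \<Rightarrow> 'a"
  assumes bil: "bilinear m" and norm_m: "\<And>a x. norm (m a x) = norm a * norm x"
  obtains H :: "'a \<times> 'a \<Rightarrow> real \<times> 'a" where "continuous_on UNIV H"
    "H ` sphere 0 1 = sphere (1/2, 0) (1/2)"
    "\<And>v. norm v = 1 \<Longrightarrow> \<exists>S. subspace S \<and> dim S = DIM('a) \<and>
      {u \<in> sphere 0 1. H u = H v} = sphere 0 1 \<inter> S"
proof -
  have linl: "linear (\<lambda>a. m a x)" and linr: "linear (m a)" for a x
    using bil by (auto simp: bilinear_def)
  \<comment> \<open>polarization of \<open>norm_m\<close>\<close>
  have inner_m: "m a x \<bullet> m c x = (norm x)\<^sup>2 * (a \<bullet> c)" for a c x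
  proof -
    have "m a x \<bullet> m c x = ((norm (m (a + c) x))\<^sup>2 - (norm (m a x))\<^sup>2 - (norm (m c x))\<^sup>2) / 2"
      by (simp add: dot_norm bilinear_ladd [OF bil])
    also have "\<dots> = (norm x)\<^sup>2 * (((norm (a + c))\<^sup>2 - (norm a)\<^sup>2 - (norm c)\<^sup>2) / 2)"
      by (simp add: norm_m power_mult_distrib algebra_simps)
    also have "\<dots> = (norm x)\<^sup>2 * (a \<bullet> c)"
      by (simp add: dot_norm)
    finally show ?thesis .
  qed
  have divide: "\<exists>a. y = m a x" if "x \<noteq> 0" for x y
  proof -
    have "a = 0" if "m a x = 0" for a
      using norm_m [of a x] that \<open>x \<noteq> 0\<close> by simp
    then have "inj (\<lambda>a. m a x)"
      by (simp add: linear_injective_0 [OF linl])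
    then have "surj (\<lambda>a. m a x)"
      by (simp add: linear_injective_imp_surjective [OF linl])
    then show ?thesis by (metis surjD)
  qed
  define z where "z x y = (\<Sum>b\<in>Basis. (y \<bullet> m b x) *\<^sub>R b)" for x y
  have z_m: "z x (m a x) = (norm x)\<^sup>2 *\<^sub>R a" for a x
    by (rule euclidean_eqI) (simp add: z_def inner_m)
  have z_0: "z 0 y = 0" "z x 0 = 0" for x y
    by (simp_all add: z_def bilinear_rzero [OF bil])
  define H where "H v = ((norm (fst v))\<^sup>2, z (fst v) (snd v))" for v
  have H_Pair: "H (x, y) = ((norm x)\<^sup>2, z x y)" for x y by (simp add: H_def)
  have cont: "continuous_on UNIV H"
    unfolding H_def z_def
    by (intro continuous_intros linear_continuous_on_compose [OF _ linr])
  have unit: "norm (x, y) = 1 \<longleftrightarrow> (norm x)\<^sup>2 + (norm y)\<^sup>2 = 1" for x y :: 'a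
    by (simp add: norm_Pair)
  have target: "(s, w) \<in> sphere (1/2, 0) (1/2) \<longleftrightarrow> (norm w)\<^sup>2 = s * (1 - s)" for s and w :: 'a
  proof -
    have "(s, w) \<in> sphere (1/2, 0) (1/2) \<longleftrightarrow> (dist (1/2, 0) (s, w))\<^sup>2 = (1/2)\<^sup>2"
      by (simp only: mem_sphere power2_eq_iff_nonneg zero_le_dist)
    also have "\<dots> \<longleftrightarrow> (norm w)\<^sup>2 = s * (1 - s)"
    proof -
      have "(dist (1/2, 0) (s, w))\<^sup>2 = (1/2 - s)\<^sup>2 + (norm w)\<^sup>2"
        by (simp add: dist_Pair_Pair dist_real_def)
      then show ?thesis by (auto simp: power2_eq_square algebra_simps)
    qed
    finally show ?thesis .
  qed
  have norm_z: "norm (z x y) = norm x * norm y" for x y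
  proof (cases "x = 0")
    case False
    then obtain a where "y = m a x" using divide by blast
    then show ?thesis by (simp add: z_m norm_m power2_eq_square)
  qed (simp add: z_0)
  have image: "H ` sphere 0 1 = sphere (1/2, 0) (1/2)"
  proof (intro equalityI subsetI)
    fix p assume "p \<in> H ` sphere 0 1"
    then obtain x y where xy: "norm (x, y) = 1" "p = H (x, y)" by auto
    have "(norm y)\<^sup>2 = 1 - (norm x)\<^sup>2" using xy(1) by (simp only: unit)
    then show "p \<in> sphere (1/2, 0) (1/2)"
      by (simp only: xy(2) H_Pair target norm_z power_mult_distrib)
  next
    fix p :: "real \<times> 'a" assume p: "p \<in> sphere (1/2, 0) (1/2)"
    obtain s w where sw: "p = (s, w)" by (cases p)
    have w: "(norm w)\<^sup>2 = s * (1 - s)" using p by (simp only: sw target)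
    obtain e :: 'a where e: "norm e = 1" by (metis norm_Basis nonempty_Basis ex_in_conv)
    show "p \<in> H ` sphere 0 1"
    proof (cases "s = 0")
      case True
      then have "p = H (0, e)" using w by (simp add: sw H_Pair z_0)
      moreover have "norm (0 :: 'a, e) = 1" using e by (simp only: unit) simp
      ultimately show ?thesis by auto
    next
      case False
      have "0 \<le> s * (1 - s)" using w zero_le_power2 [of "norm w"] by linarith
      then have s: "s > 0" using False by (auto simp: zero_le_mult_iff)
      \<comment> \<open>the slope over \<open>(s, w)\<close> is \<open>w /\<^sub>R s\<close>, and \<open>x\<close> has to have squared norm \<open>s\<close>\<close>
      define x where "x = sqrt s *\<^sub>R e"
      define y where "y = m (w /\<^sub>R s) x"
      have x: "(norm x)\<^sup>2 = s" using s e by (simp add: x_def)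
      have "(norm y)\<^sup>2 = (norm w)\<^sup>2 / s\<^sup>2 * (norm x)\<^sup>2"
        using s by (simp add: y_def norm_m power_mult_distrib divide_inverse power_inverse)
      also have "\<dots> = 1 - s"
        unfolding w x using s by (simp add: power2_eq_square)
      finally have "(norm y)\<^sup>2 = 1 - s" .
      then have "norm (x, y) = 1" using x by (simp only: unit)
      moreover have "H (x, y) = p"
        using s by (simp add: H_Pair x y_def z_m sw)
      ultimately show ?thesis by (auto intro!: image_eqI [of _ H "(x, y)"])
    qed
  qed
  have fib: "\<exists>S. subspace S \<and> dim S = DIM('a) \<and> {u \<in> sphere 0 1. H u = H v} = sphere 0 1 \<inter> S"
    if v: "norm v = 1" for v
  proof -
    obtain x0 y0 where v_eq: "v = (x0, y0)" by (cases v)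
    show ?thesis
    proof (cases "x0 = 0")
      case True
      define g where "g = (\<lambda>y. (0 :: 'a, y :: 'a))"
      have g: "linear g" "inj g" by (auto simp: g_def inj_def intro!: linearI)
      have "u \<in> {u \<in> sphere 0 1. H u = H v} \<longleftrightarrow> u \<in> sphere 0 1 \<inter> range g" for u
        by (cases u) (auto simp: v_eq True H_Pair z_0 g_def image_iff)
      then have "{u \<in> sphere 0 1. H u = H v} = sphere 0 1 \<inter> range g" by blast
      moreover have "dim (range g) = DIM('a)" using g by (simp add: dim_image_eq)
      ultimately show ?thesis
        using linear_subspace_image [OF g(1) subspace_UNIV] by blast
    next
      case False
      then obtain a where a: "y0 = m a x0" using divide by blast
      define g where "g = (\<lambda>x. (x, m a x))"
      have g: "linear g" "inj g"
        by (auto simp: g_def inj_def bilinear_radd [OF bil] bilinear_rmul [OF bil] intro!: linearI)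
      \<comment> \<open>on the graph of slope \<open>a\<close>, unit length fixes \<open>norm x\<close>, so \<open>H\<close> is constant there\<close>
      have gn: "norm (g x) = 1 \<longleftrightarrow> (1 + (norm a)\<^sup>2) * (norm x)\<^sup>2 = 1" for x
        unfolding g_def unit norm_m by (simp add: power_mult_distrib algebra_simps)
      have gv: "v = g x0" by (simp add: g_def v_eq a)
      have H_g: "H (g x) = ((norm x)\<^sup>2, (norm x)\<^sup>2 *\<^sub>R a)" for x
        by (simp add: g_def H_Pair z_m)
      have pos: "1 + (norm a)\<^sup>2 > 0" by (simp add: add_pos_nonneg)
      have "{u \<in> sphere 0 1. H u = H v} = sphere 0 1 \<inter> range g"
      proof (intro equalityI subsetI)
        fix u assume u: "u \<in> {u \<in> sphere 0 1. H u = H v}"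
        obtain x y where xy: "u = (x, y)" by (cases u)
        have eq: "(norm x)\<^sup>2 = (norm x0)\<^sup>2" "z x y = (norm x0)\<^sup>2 *\<^sub>R a"
          using u by (auto simp: gv H_g xy H_Pair)
        then have "x \<noteq> 0" using False by auto
        then obtain b where b: "y = m b x" using divide by blast
        then have "(norm x)\<^sup>2 *\<^sub>R b = (norm x)\<^sup>2 *\<^sub>R a" using eq z_m by metis
        then have "b = a" using \<open>x \<noteq> 0\<close> by simp
        then have "u = g x" by (simp add: xy b g_def)
        then show "u \<in> sphere 0 1 \<inter> range g" using u by blast
      next
        fix u assume u: "u \<in> sphere 0 1 \<inter> range g"
        then obtain x where x: "u = g x" "norm (g x) = 1" by auto
        have "(1 + (norm a)\<^sup>2) * (norm x)\<^sup>2 = (1 + (norm a)\<^sup>2) * (norm x0)\<^sup>2"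
          using x(2) v gn by (simp add: gv)
        then have "(norm x)\<^sup>2 = (norm x0)\<^sup>2" using pos by simp
        then show "u \<in> {u \<in> sphere 0 1. H u = H v}"
          using u by (simp add: x gv H_g)
      qed
      moreover have "dim (range g) = DIM('a)" using g by (simp add: dim_image_eq)
      ultimately show ?thesis
        using linear_subspace_image [OF g(1) subspace_UNIV] by blast
    qed
  qed
  show thesis using that cont image fib by blast
qed

text \<open>The Cayley-Dickson products: \<open>(a, b)\<close> times \<open>(c, d)\<close> is
  \<open>(a c - d\<^sup>* b, d a + b c\<^sup>*)\<close>, where the star denotes conjugation.\<close>

definition quat_mult :: "complex \<times> complex \<Rightarrow> complex \<times> complex \<Rightarrow> complex \<times> complex" where
  "quat_mult p q = (fst p * fst q - cnj (snd q) * snd p, snd q * fst p + snd p * cnj (fst q))"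

definition quat_cnj :: "complex \<times> complex \<Rightarrow> complex \<times> complex" where
  "quat_cnj p = (cnj (fst p), - snd p)"

definition oct_mult :: "(complex \<times> complex) \<times> (complex \<times> complex) \<Rightarrow>
    (complex \<times> complex) \<times> (complex \<times> complex) \<Rightarrow> (complex \<times> complex) \<times> (complex \<times> complex)" where
  "oct_mult p q = (quat_mult (fst p) (fst q) - quat_mult (quat_cnj (snd q)) (snd p),
    quat_mult (snd q) (fst p) + quat_mult (snd p) (quat_cnj (fst q)))"

lemma bilinear_quat_mult: "bilinear quat_mult"
  unfolding bilinear_def
  by (intro conjI allI linearI) (auto simp: quat_mult_def scaleR_conv_of_real algebra_simps)

lemma linear_quat_cnj: "linear quat_cnj"
  by (intro linearI) (auto simp: quat_cnj_def scaleR_conv_of_real)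

lemma bilinear_oct_mult: "bilinear oct_mult"
  unfolding bilinear_def
  by (intro conjI allI linearI)
    (auto simp: oct_mult_def linear_add [OF linear_quat_cnj] linear_scale [OF linear_quat_cnj]
      bilinear_ladd [OF bilinear_quat_mult] bilinear_radd [OF bilinear_quat_mult]
      bilinear_lmul [OF bilinear_quat_mult] bilinear_rmul [OF bilinear_quat_mult] scaleR_diff_right scaleR_add_right)

lemma norm2_quat: "(norm p)\<^sup>2 = (Re (fst p))\<^sup>2 + (Im (fst p))\<^sup>2 + (Re (snd p))\<^sup>2 + (Im (snd p))\<^sup>2"
  for p :: "complex \<times> complex"
  by (simp add: norm_prod_def cmod_power2)

lemma norm_quat_mult: "norm (quat_mult p q) = norm p * norm q"
proof -
  have "(norm (quat_mult p q))\<^sup>2 = (norm p * norm q)\<^sup>2"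
    unfolding power_mult_distrib norm2_quat quat_mult_def by (simp add: power2_eq_square algebra_simps)
  then show ?thesis by (simp add: power2_eq_iff_nonneg)
qed

lemma norm_quat_cnj: "norm (quat_cnj p) = norm p"
  by (simp add: quat_cnj_def norm_prod_def)

text \<open>Both sides are the real part of \<open>d a c b\<^sup>*\<close>: the real part of a product of quaternions is
  invariant under cyclic permutation. By this identity the mixed terms cancel
  in the norm of the product of two octonions.\<close>

lemma quat_inner_cross:
  "quat_mult a c \<bullet> quat_mult (quat_cnj d) b = quat_mult d a \<bullet> quat_mult b (quat_cnj c)"
  unfolding inner_prod_def inner_complex_def quat_mult_def quat_cnj_def
  by (simp add: power2_eq_square algebra_simps)

lemma norm_oct_mult: "norm (oct_mult p q) = norm p * norm q"
proof -
  obtain a b c d where p: "p = (a, b)" and q: "q = (c, d)" by (cases p; cases q)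
  have "(norm (oct_mult p q))\<^sup>2 =
      (norm (quat_mult a c - quat_mult (quat_cnj d) b))\<^sup>2 +
      (norm (quat_mult d a + quat_mult b (quat_cnj c)))\<^sup>2"
    by (simp add: oct_mult_def p q norm_Pair)
  also have "\<dots> = (norm (quat_mult a c))\<^sup>2 + (norm (quat_mult (quat_cnj d) b))\<^sup>2 +
      (norm (quat_mult d a))\<^sup>2 + (norm (quat_mult b (quat_cnj c)))\<^sup>2"
    using quat_inner_cross [of a c d b]
    by (simp add: power2_norm_eq_inner inner_diff_left inner_diff_right inner_add_left inner_add_right
        inner_commute)
  also have "\<dots> = ((norm a)\<^sup>2 + (norm b)\<^sup>2) * ((norm c)\<^sup>2 + (norm d)\<^sup>2)"
    by (simp add: norm_quat_mult norm_quat_cnj power_mult_distrib algebra_simps)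
  also have "\<dots> = (norm p * norm q)\<^sup>2"
    by (simp add: p q norm_Pair power_mult_distrib)
  finally show ?thesis by (simp add: power2_eq_iff_nonneg)
qed

text \<open>A linear isometry of the ambient space with two copies of the space that carries the product
  moves the fibration to the unit sphere over projective space.\<close>

lemma normed_product_bound:
  fixes m :: "'a::euclidean_space \<Rightarrow> 'a \<Rightarrow> 'a"
  assumes "bilinear m" "\<And>a x. norm (m a x) = norm a * norm x"
    and dim: "Suc CARD('n::finite) = 2 * DIM('a)" and l: "DIM('a) = Suc l"
  shows "\<exists>(N :: ((real^'n) \<times> real) set topology) (f :: ((real^'n) \<times> real) set \<Rightarrow> ((real^'n) \<times> real) set).
    topological_manifold DIM('a) N \<and> continuous_map rp_topology N f \<and>
    (\<forall>P :: ((real^'n) \<times> real) set set. rp_subspace l P \<longrightarrow>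
      (\<forall>y \<in> topspace N. \<forall>t > 0.
        rp_volume (rp_nbhd t {p \<in> rp. f p = y}) \<le> rp_volume (rp_nbhd t P)))"
proof -
  obtain H :: "'a \<times> 'a \<Rightarrow> real \<times> 'a" where contH: "continuous_on UNIV H"
      and image: "H ` sphere 0 1 = sphere (1/2, 0) (1/2)"
      and fibH: "\<And>v. norm v = 1 \<Longrightarrow> \<exists>S. subspace S \<and> dim S = DIM('a) \<and>
        {u \<in> sphere 0 1. H u = H v} = sphere 0 1 \<inter> S"
    using normed_product_hopf_map [OF assms(1,2)] by blast
  have "DIM((real^'n) \<times> real) = DIM('a \<times> 'a)" using dim by simp
  then obtain j :: "(real^'n) \<times> real \<Rightarrow> 'a \<times> 'a" and j' where lin: "linear j" "linear j'"
      and norm_j: "\<And>v. norm (j v) = norm v" "\<And>w. norm (j' w) = norm w"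
      and inv: "\<And>v. j' (j v) = v" "\<And>w. j (j' w) = w"
    using isomorphisms_UNIV_UNIV by blast
  have j_sphere: "j ` sphere 0 1 = sphere 0 1"
  proof (intro equalityI subsetI)
    fix w :: "'a \<times> 'a" assume "w \<in> sphere 0 1"
    then have "j' w \<in> sphere 0 1" using norm_j(2) [of w] by simp
    then have "j (j' w) \<in> j ` sphere 0 1" by (rule imageI)
    then show "w \<in> j ` sphere 0 1" unfolding inv(2) .
  next
    fix w assume "w \<in> j ` sphere 0 1"
    then obtain v where "v \<in> sphere 0 1" "w = j v" by blast
    then show "w \<in> sphere 0 1" using norm_j(1) [of v] by simp
  qed
  show ?thesis
  proof (rule great_sphere_fibration_bound [where F = "H \<circ> j"])
    show "continuous_on (sphere 0 1) (H \<circ> j)"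
      using lin(1) by (intro continuous_on_compose linear_continuous_on continuous_on_subset [OF contH])
        (simp_all add: linear_conv_bounded_linear)
    show "topological_manifold DIM('a) (top_of_set ((H \<circ> j) ` sphere 0 1))"
      unfolding image_comp [symmetric] j_sphere image by (rule topological_manifold_sphere) simp_all
  next
    fix v :: "(real^'n) \<times> real" assume "norm v = 1"
    then have "norm (j v) = 1" using norm_j(1) [of v] by simp
    from fibH [OF this] obtain S where S: "subspace S" "dim S = DIM('a)"
        "{u \<in> sphere 0 1. H u = H (j v)} = sphere 0 1 \<inter> S"
      by blast
    have "inj_on j' (span S)" using inv(2) by (rule inj_on_inverseI)
    then have "dim (j' ` S) = DIM('a)"
      using S(2) by (simp add: dim_image_eq [OF lin(2)])
    moreover have "{u \<in> sphere 0 1. (H \<circ> j) u = (H \<circ> j) v} = sphere 0 1 \<inter> j' ` S"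
    proof (rule Set.set_eqI)
      fix u
      have "u \<in> {u \<in> sphere 0 1. (H \<circ> j) u = (H \<circ> j) v} \<longleftrightarrow> j u \<in> {u \<in> sphere 0 1. H u = H (j v)}"
        using norm_j(1) [of u] by simp
      also have "\<dots> \<longleftrightarrow> u \<in> sphere 0 1 \<and> j u \<in> S"
        unfolding S(3) using norm_j(1) [of u] by simp
      also have "j u \<in> S \<longleftrightarrow> u \<in> j' ` S"
        using inv by (metis image_iff)
      finally show "u \<in> {u \<in> sphere 0 1. (H \<circ> j) u = (H \<circ> j) v} \<longleftrightarrow> u \<in> sphere 0 1 \<inter> j' ` S"
        by simp
    qed
    ultimately show "\<exists>S. subspace S \<and> dim S = Suc l \<and>
        {u \<in> sphere 0 1. (H \<circ> j) u = (H \<circ> j) v} = sphere 0 1 \<inter> S"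
      using linear_subspace_image [OF lin(2) S(1)] l by metis
  qed
qed

section \<open>Tightness of the bound\<close>

theorem theorem2p15:
  fixes n k :: nat
  assumes "CARD('n::finite) = n"
    and "(odd n \<and> k = n - 1) \<or> (n = 7 \<and> k = 4) \<or> (n = 15 \<and> k = 8)"
  shows "\<exists>(N :: ((real^'n) \<times> real) set topology) (f :: ((real^'n) \<times> real) set \<Rightarrow> ((real^'n) \<times> real) set).
    topological_manifold k N \<and> continuous_map rp_topology N f \<and>
    (\<forall>P :: ((real^'n) \<times> real) set set. rp_subspace (n - k) P \<longrightarrow>
      (\<forall>y \<in> topspace N. \<forall>t > 0.
        rp_volume (rp_nbhd t {p \<in> rp. f p = y}) \<le> rp_volume (rp_nbhd t P)))"
proof -
  have dimV: "DIM((real^'n) \<times> real) = Suc n" using assms(1) by simp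
  from assms(2) show ?thesis
  proof (elim disjE conjE)
    assume "odd n" and k: "k = n - 1"
    then have "n = Suc k" by (cases n) auto
    have "even DIM((real^'n) \<times> real)" "DIM((real^'n) \<times> real) = Suc (Suc k)"
      using \<open>odd n\<close> \<open>n = Suc k\<close> unfolding dimV by auto
    then obtain F :: "(real^'n) \<times> real \<Rightarrow> nat \<Rightarrow> (real^'n) \<times> real" where
        F: "continuous_on (sphere 0 1) F" "topological_manifold k (top_of_set (F ` sphere 0 1))"
        and fib: "\<And>v. norm v = 1 \<Longrightarrow> \<exists>S. subspace S \<and> dim S = 2 \<and>
          {u \<in> sphere 0 1. F u = F v} = sphere 0 1 \<inter> S"
      using complex_projective_map_exists by blast
    have "n - k = 1" using \<open>n = Suc k\<close> by simp
    show ?thesis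
      unfolding \<open>n - k = 1\<close>
    proof (rule great_sphere_fibration_bound [OF F])
      fix v :: "(real^'n) \<times> real" assume "norm v = 1"
      then show "\<exists>S. subspace S \<and> dim S = Suc 1 \<and> {u \<in> sphere 0 1. F u = F v} = sphere 0 1 \<inter> S"
        using fib [of v] by (simp only: Suc_1)
    qed
  next
    assume nk: "n = 7" "k = 4"
    have "DIM(complex \<times> complex) = k" "n - k = 3" using nk by simp_all
    then show ?thesis
      using normed_product_bound [OF bilinear_quat_mult norm_quat_mult, where 'n = 'n and l = 3] assms(1) nk
      by simp
  next
    assume nk: "n = 15" "k = 8"
    have "DIM((complex \<times> complex) \<times> (complex \<times> complex)) = k" "n - k = 7" using nk by simp_all
    then show ?thesis
      using normed_product_bound [OF bilinear_oct_mult norm_oct_mult, where 'n = 'n and l = 7] assms(1) nk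
      by simp
  qed
qed

end
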